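(* Let $G$ be a finite simple graph. Then $\iota(\mathrm{Mid}(G)) = \nu'(G)$, where $\nu'(G)$ is the minimum value of $|M|$ over all maximal matchings $M$ of $G$.
   Context: For a graph $H$ and $S\subseteq V(H)$, let $N_H[S]=S\cup\{u: u \text{ adjacent to some vertex of } S\}$. A set $S\subseteq V(H)$ is an isolating set of $H$ if $V(H)\setminus N_H[S]$ is an independent set of $H$; the isolation number $\iota(H)$ is the minimum size of an isolating set of $H$. The middle graph $\mathrm{Mid}(G)$ of $G$ is the graph obtained from $G$ by subdividing each edge of $G$ exactly once and then joining by an edge each pair of subdivision vertices whose corresponding edges of $G$ share an endpoint; i.e. $V(\mathrm{Mid}(G))=V(G)\cup\{m_e: e\in E(G)\}$, $v\sim m_e$ iff $v$ is an endpoint of $e$, $m_e\sim m_f$ iff $e\ne f$ share an endpoint, and no two vertices of $V(G)$ are adjacent. A maximal matching is a matching not properly contained in another matching. *)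

theory Defs
  imports Main
begin

(* A graph is a pair (vertex set, edge set), edges being sets of endpoints. *)
type_synonym 'a ugraph = "'a set \<times> 'a set set"

abbreviation verts :: "'a ugraph \<Rightarrow> 'a set" where
  "verts G \<equiv> fst G"

abbreviation edges :: "'a ugraph \<Rightarrow> 'a set set" where
  "edges G \<equiv> snd G"

definition finite_simple_graph :: "'a ugraph \<Rightarrow> bool" where
  "finite_simple_graph G \<longleftrightarrow>
     finite (verts G) \<and> (\<forall>e\<in>edges G. e \<subseteq> verts G \<and> card e = 2)"

definition adjacent :: "'a ugraph \<Rightarrow> 'a \<Rightarrow> 'a \<Rightarrow> bool" where
  "adjacent G u v \<longleftrightarrow> {u, v} \<in> edges G"

definition closed_nbhd :: "'a ugraph \<Rightarrow> 'a set \<Rightarrow> 'a set" where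
  "closed_nbhd G S = S \<union> {u \<in> verts G. \<exists>s\<in>S. adjacent G u s}"

definition independent_set :: "'a ugraph \<Rightarrow> 'a set \<Rightarrow> bool" where
  "independent_set G I \<longleftrightarrow> I \<subseteq> verts G \<and> (\<forall>u\<in>I. \<forall>v\<in>I. \<not> adjacent G u v)"

definition isolating_set :: "'a ugraph \<Rightarrow> 'a set \<Rightarrow> bool" where
  "isolating_set G S \<longleftrightarrow>
     S \<subseteq> verts G \<and> independent_set G (verts G - closed_nbhd G S)"

definition isolation_number :: "'a ugraph \<Rightarrow> nat" where
  "isolation_number G = Min {card S | S. isolating_set G S}"

(* Inl v is the original vertex v; Inr e is the subdivision vertex of the edge e. *)
definition Mid :: "'a ugraph \<Rightarrow> ('a + 'a set) ugraph" where
  "Mid G =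
    (Inl ` verts G \<union> Inr ` edges G,
     {{Inl v, Inr e} | v e. e \<in> edges G \<and> v \<in> e} \<union>
     {{Inr e, Inr f} | e f. e \<in> edges G \<and> f \<in> edges G \<and> e \<noteq> f \<and> e \<inter> f \<noteq> {}})"

definition matching :: "'a ugraph \<Rightarrow> 'a set set \<Rightarrow> bool" where
  "matching G M \<longleftrightarrow>
     M \<subseteq> edges G \<and> (\<forall>e\<in>M. \<forall>f\<in>M. e \<noteq> f \<longrightarrow> e \<inter> f = {})"

definition maximal_matching :: "'a ugraph \<Rightarrow> 'a set set \<Rightarrow> bool" where
  "maximal_matching G M \<longleftrightarrow> matching G M \<and> \<not> (\<exists>M'. matching G M' \<and> M \<subset> M')"

definition min_maximal_matching_number :: "'a ugraph \<Rightarrow> nat" where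
  "min_maximal_matching_number G = Min {card M | M. maximal_matching G M}"

lemma finite_simple_graph_finite_edges:
  assumes "finite_simple_graph G"
  shows "finite (edges G)"
proof (rule finite_subset)
  show "edges G \<subseteq> Pow (verts G)"
    using assms by (auto simp: finite_simple_graph_def)
  show "finite (Pow (verts G))"
    using assms by (simp add: finite_simple_graph_def)
qed

lemma finite_simple_graph_Mid:
  assumes "finite_simple_graph G"
  shows "finite_simple_graph (Mid G)"
proof -
  have "finite (verts G)" "\<And>e. e \<in> edges G \<Longrightarrow> e \<subseteq> verts G"
    using assms by (auto simp: finite_simple_graph_def)
  then show ?thesis
    using finite_simple_graph_finite_edges[OF assms]
    unfolding finite_simple_graph_def Mid_def by (auto simp: card_2_iff doubleton_eq_iff)
qed

(* Both minima range over finite nonempty sets, so Min is meaningful. *)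

lemma isolating_sizes_finite_nonempty:
  assumes "finite_simple_graph G"
  shows "finite {card S | S. isolating_set G S}" "{card S | S. isolating_set G S} \<noteq> {}"
proof -
  have "{card S | S. isolating_set G S} \<subseteq> card ` Pow (verts G)"
    by (auto simp: isolating_set_def)
  moreover have "finite (card ` Pow (verts G))"
    using assms by (simp add: finite_simple_graph_def)
  ultimately show "finite {card S | S. isolating_set G S}"
    by (rule finite_subset)
  have "isolating_set G (verts G)"
    by (auto simp: isolating_set_def independent_set_def closed_nbhd_def)
  then show "{card S | S. isolating_set G S} \<noteq> {}" by blast
qed

lemma maximal_matching_sizes_finite_nonempty:
  assumes "finite_simple_graph G"
  shows "finite {card M | M. maximal_matching G M}" "{card M | M. maximal_matching G M} \<noteq> {}"
proof -
  note fE = finite_simple_graph_finite_edges[OF assms]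
  have "{card M | M. maximal_matching G M} \<subseteq> card ` Pow (edges G)"
    by (auto simp: maximal_matching_def matching_def)
  then show "finite {card M | M. maximal_matching G M}"
    by (rule finite_subset) (simp add: fE)
  have "{M. matching G M} \<subseteq> Pow (edges G)" by (auto simp: matching_def)
  then have "finite {M. matching G M}"
    by (rule finite_subset) (simp add: fE)
  moreover have "{} \<in> {M. matching G M}" by (simp add: matching_def)
  ultimately obtain M where "M \<in> {M. matching G M}"
      "\<forall>M'\<in>{M. matching G M}. M \<subseteq> M' \<longrightarrow> M = M'"
    using finite_has_maximal[of "{M. matching G M}"] by blast
  then have "maximal_matching G M" by (auto simp: maximal_matching_def)
  then show "{card M | M. maximal_matching G M} \<noteq> {}" by blast
qed

end

theory Submission
  imports Defs
begin

text \<open>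
  The subdivision vertices of a maximal matching dominate every subdivision vertex, which leaves
  only pairwise nonadjacent original vertices. Conversely, an isolating set \<open>S\<close> of the middle
  graph dominates every subdivision vertex, since an undominated \<open>m_e\<close> would have an undominated
  endpoint as neighbour. Let \<open>D\<close> be the set of edges of \<open>G\<close> whose subdivision vertices lie in
  \<open>S\<close>, take a maximal matching \<open>M\<close> inside \<open>D\<close>, and extend it to a maximal matching \<open>N\<close> of \<open>G\<close>.
  An edge \<open>g\<close> in \<open>N - M\<close> contains a vertex from \<open>S\<close> or meets an edge \<open>d\<close> in \<open>D - M\<close>. As \<open>d\<close>
  already has one endpoint covered by \<open>M\<close>, it meets only one such \<open>g\<close>; hence \<open>|N| \<le> |S|\<close>.
\<close>

lemma adjacent_Mid_simps:
  "adjacent (Mid G) (Inl u) (Inl v) \<longleftrightarrow> False"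
  "adjacent (Mid G) (Inl u) (Inr e) \<longleftrightarrow> e \<in> edges G \<and> u \<in> e"
  "adjacent (Mid G) (Inr e) (Inl u) \<longleftrightarrow> e \<in> edges G \<and> u \<in> e"
  "adjacent (Mid G) (Inr e) (Inr f) \<longleftrightarrow>
     e \<in> edges G \<and> f \<in> edges G \<and> e \<noteq> f \<and> e \<inter> f \<noteq> {}"
  unfolding adjacent_def Mid_def by (auto simp: doubleton_eq_iff)

lemma verts_Mid: "verts (Mid G) = Inl ` verts G \<union> Inr ` edges G"
  by (simp add: Mid_def)

lemma matching_extends_to_maximal:
  assumes "finite (edges G)" and "matching G M"
  obtains N where "maximal_matching G N" "M \<subseteq> N"
proof -
  have "finite {N. matching G N}"
    by (rule finite_subset[of _ "Pow (edges G)"]) (auto simp: matching_def assms(1))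
  from finite_has_maximal2[OF this, of M] assms(2) obtain N
    where "matching G N" "M \<subseteq> N" "\<forall>N'. matching G N' \<longrightarrow> N \<subseteq> N' \<longrightarrow> N = N'"
    by auto
  then show thesis
    using that[of N] by (auto simp: maximal_matching_def)
qed

lemma maximal_matching_meets_edge:
  assumes "maximal_matching G M" and "e \<in> edges G" and "e \<notin> M"
  shows "\<exists>f\<in>M. e \<inter> f \<noteq> {}"
proof (rule ccontr)
  assume "\<not> ?thesis"
  then have "matching G (insert e M)"
    using assms(1,2) by (auto simp: maximal_matching_def matching_def)
  with assms(1,3) show False
    unfolding maximal_matching_def by blast
qed

lemma isolating_set_Mid_if_maximal_matching:
  assumes "maximal_matching G M"
  shows "isolating_set (Mid G) (Inr ` M)"
proof -
  have ME: "M \<subseteq> edges G"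
    using assms by (simp add: maximal_matching_def matching_def)
  have "Inr e \<in> closed_nbhd (Mid G) (Inr ` M)" if e: "e \<in> edges G" for e
  proof (cases "e \<in> M")
    case False
    then obtain f where "f \<in> M" "e \<inter> f \<noteq> {}"
      using maximal_matching_meets_edge[OF assms e] by blast
    then show ?thesis
      using e ME False by (auto simp: closed_nbhd_def adjacent_Mid_simps verts_Mid)
  qed (simp add: closed_nbhd_def)
  then show ?thesis
    using ME by (auto simp: isolating_set_def independent_set_def verts_Mid adjacent_Mid_simps)
qed

text \<open>A vertex of \<open>S\<close> that dominates an endpoint \<open>u\<close> of
  \<open>e\<close> is \<open>Inl u\<close> or some \<open>Inr f\<close> with
  \<open>u \<in> f\<close>, and either one also dominates \<open>Inr e\<close>. So an undominated
  \<open>Inr e\<close> leaves the adjacent pair \<open>Inl u\<close>, \<open>Inr e\<close>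
  uncovered. The case \<open>f = e\<close> accounts for \<open>Inr e \<in> S\<close>.\<close>

lemma isolating_set_Mid_meets_edge:
  assumes "finite_simple_graph G" and S: "isolating_set (Mid G) S" and e: "e \<in> edges G"
  shows "(\<exists>v\<in>e. Inl v \<in> S) \<or> (\<exists>f\<in>edges G. Inr f \<in> S \<and> e \<inter> f \<noteq> {})"
proof (rule ccontr)
  assume none: "\<not> ?thesis"
  have "e \<subseteq> verts G" "card e = 2"
    using assms(1) e by (auto simp: finite_simple_graph_def)
  then obtain u where u: "u \<in> e" "u \<in> verts G"
    by (metis card.empty ex_in_conv subsetD zero_neq_numeral)
  have "\<not> adjacent (Mid G) (Inr e) s" "\<not> adjacent (Mid G) (Inl u) s" if "s \<in> S" for s
    using that none u by (cases s; auto simp: adjacent_Mid_simps)+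
  moreover have "Inr e \<notin> S" "Inl u \<notin> S"
    using none e u by auto
  ultimately have "Inr e \<notin> closed_nbhd (Mid G) S" "Inl u \<notin> closed_nbhd (Mid G) S"
    by (auto simp: closed_nbhd_def)
  then have "\<not> adjacent (Mid G) (Inl u) (Inr e)"
    using S e u by (auto simp: isolating_set_def independent_set_def verts_Mid)
  then show False
    using e u by (simp add: adjacent_Mid_simps)
qed

text \<open>One of the two elements of \<open>d\<close> lies in \<open>f\<close>; \<open>g\<close>
  and \<open>h\<close> avoid it, so both contain the other.\<close>

lemma edge_meets_two_disjoint_sets:
  assumes "card d = 2" and "d \<inter> f \<noteq> {}" and "d \<inter> g \<noteq> {}" and "d \<inter> h \<noteq> {}"
    and "f \<inter> g = {}" and "f \<inter> h = {}"
  shows "g \<inter> h \<noteq> {}"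
  using assms by (auto simp: card_2_iff)

lemma maximal_matching_le_isolating_set_Mid:
  assumes G: "finite_simple_graph G" and S: "isolating_set (Mid G) S"
  obtains N where "maximal_matching G N" "card N \<le> card S"
proof -
  define D where "D = {d \<in> edges G. Inr d \<in> S}"
  have finE: "finite (edges G)"
    by (rule finite_simple_graph_finite_edges[OF G])
  have finS: "finite S"
    using S finite_simple_graph_Mid[OF G]
    by (auto simp: isolating_set_def finite_simple_graph_def intro: finite_subset)
  have "finite (edges (verts G, D))" "matching (verts G, D) {}"
    using finE by (auto simp: D_def matching_def)
  \<comment> \<open>Maximality is relative to the edge set \<open>D\<close>: every edge in
    \<open>D - M\<close> meets an edge of \<open>M\<close>.\<close>
  then obtain M where M: "maximal_matching (verts G, D) M"
    by (rule matching_extends_to_maximal)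
  then have MD: "M \<subseteq> D" and "matching G M"
    by (auto simp: maximal_matching_def matching_def D_def)
  then obtain N where N: "maximal_matching G N" "M \<subseteq> N"
    using matching_extends_to_maximal[OF finE] by blast
  have NE: "N \<subseteq> edges G" and disj: "\<And>e f. e \<in> N \<Longrightarrow> f \<in> N \<Longrightarrow> e \<noteq> f \<Longrightarrow> e \<inter> f = {}"
    using N(1) by (auto simp: maximal_matching_def matching_def)
  \<comment> \<open>\<open>R g s\<close> allows the edge \<open>g\<close> of \<open>N\<close> to be
    charged to \<open>s\<close>. Taking \<open>d\<close> outside \<open>M\<close> reserves the
    vertices \<open>Inr d\<close> with \<open>d \<in> M\<close> for the edges of \<open>M\<close>
    themselves.\<close>
  define R where "R g s \<longleftrightarrow>
      (if g \<in> M then s = Inr g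
       else (\<exists>v\<in>g. s = Inl v) \<or> (\<exists>d\<in>D - M. s = Inr d \<and> d \<inter> g \<noteq> {}))" for g s
  have "card N \<le> card S"
  proof (rule card_le_if_inj_on_rel[of S N R])
    fix g assume g: "g \<in> N"
    show "\<exists>s. s \<in> S \<and> R g s"
    proof (cases "g \<in> M")
      case True
      then show ?thesis
        using MD by (auto simp: R_def D_def)
    next
      case False
      from g NE have "g \<in> edges G" ..
      from isolating_set_Mid_meets_edge[OF G S this] show ?thesis
      proof
        assume "\<exists>v\<in>g. Inl v \<in> S"
        then show ?thesis
          using False by (auto simp: R_def)
      next
        assume "\<exists>f\<in>edges G. Inr f \<in> S \<and> g \<inter> f \<noteq> {}"
        then obtain d where d: "d \<in> D" "g \<inter> d \<noteq> {}" "Inr d \<in> S"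
          by (auto simp: D_def)
        \<comment> \<open>Otherwise \<open>d\<close> and \<open>g\<close> would be distinct edges of
          the matching \<open>N\<close> that meet.\<close>
        have "d \<notin> M"
          using d(2) False g N(2) disj[of g d] by auto
        then have "R g (Inr d)"
          using False d by (auto simp: R_def)
        with d(3) show ?thesis by blast
      qed
    qed
  next
    fix g h s assume gh: "g \<in> N" "h \<in> N" and R: "R g s" "R h s"
    show "g = h"
    proof (cases "g \<in> M \<or> h \<in> M")
      case True
      then show ?thesis
        using R by (auto simp: R_def split: if_splits)
    next
      case False
      \<comment> \<open>A shared charge is either a common vertex of \<open>g\<close> and
        \<open>h\<close> or an edge \<open>d\<close> meeting both.\<close>
      then consider v where "v \<in> g" "v \<in> h"
        | d where "d \<in> D - M" "d \<inter> g \<noteq> {}" "d \<inter> h \<noteq> {}"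
        using R by (auto simp: R_def)
      then show ?thesis
      proof cases
        case 1
        then show ?thesis
          using disj gh by blast
      next
        case 2
        then obtain f where f: "f \<in> M" "d \<inter> f \<noteq> {}"
          using maximal_matching_meets_edge[OF M, of d] by auto
        have "card d = 2"
          using 2 G by (auto simp: D_def finite_simple_graph_def)
        \<comment> \<open>\<open>f\<close> lies in \<open>M\<close>, hence in \<open>N\<close>, and
          differs from \<open>g\<close> and \<open>h\<close>, which lie outside
          \<open>M\<close>.\<close>
        moreover have "f \<inter> g = {}" "f \<inter> h = {}"
          using False f N(2) gh disj by blast+
        ultimately have "g \<inter> h \<noteq> {}"
          using edge_meets_two_disjoint_sets f(2) 2 by metis
        then show ?thesis
          using disj gh by blast
      qed
    qed
  qed (rule finS)
  with N(1) show thesis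
    by (rule that)
qed

theorem theorem1:
  fixes G :: "'a ugraph"
  assumes "finite_simple_graph G"
  shows "isolation_number (Mid G) = min_maximal_matching_number G"
proof (rule antisym)
  note iso = isolating_sizes_finite_nonempty[OF finite_simple_graph_Mid[OF assms]]
  note mat = maximal_matching_sizes_finite_nonempty[OF assms]
  obtain M where M: "maximal_matching G M" "min_maximal_matching_number G = card M"
    using Min_in[OF mat] by (auto simp: min_maximal_matching_number_def)
  have "card (Inr ` M :: ('a + 'a set) set) = card M"
    by (simp add: card_image)
  then have "card M \<in> {card S | S. isolating_set (Mid G) S}"
    using isolating_set_Mid_if_maximal_matching[OF M(1)] by (metis (mono_tags, lifting) mem_Collect_eq)
  then show "isolation_number (Mid G) \<le> min_maximal_matching_number G"
    unfolding isolation_number_def M(2) by (rule Min_le[OF iso(1)])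
  obtain S where S: "isolating_set (Mid G) S" "isolation_number (Mid G) = card S"
    using Min_in[OF iso] by (auto simp: isolation_number_def)
  obtain N where N: "maximal_matching G N" "card N \<le> card S"
    by (rule maximal_matching_le_isolating_set_Mid[OF assms S(1)])
  have "min_maximal_matching_number G \<le> card N"
    unfolding min_maximal_matching_number_def using N(1) by (intro Min_le[OF mat(1)]) blast
  with N(2) S(2) show "min_maximal_matching_number G \<le> isolation_number (Mid G)"
    by simp
qed

end
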